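(* Let $\mathbb{X}=(X_n,n\ge 1)$ be a strictly stationary sequence of real random variables on a probability space $(\Omega,\mathcal{F},\mathbb{P})$, let $\lambda\in(0,1)$, and let $(k_n,n\ge 1)$ be a sequence of integers such that $1\le k_n\le n$ for all $n$ and $\lim_{n\to\infty}k_n/n=\lambda$. If the conditional $\lambda$th quantile $\pi_{\lambda}(X_1|\mathcal{I}^{\mathbb{X}})$ of $X_1$ given $\mathcal{I}^{\mathbb{X}}$ is unique, then $$X_{k_n:n}\to\pi_{\lambda}(X_1|\mathcal{I}^{\mathbb{X}})\quad \mathbb{P}\text{-almost surely as } n\to\infty.$$
   Context: Order statistics: $X_{1:n}\le\ldots\le X_{n:n}$ denote the order statistics of the sample $(X_1,\ldots,X_n)$, i.e. the values $X_1,\ldots,X_n$ arranged in nondecreasing order. Conditional quantile: let $X$ be a real random variable on $(\Omega,\mathcal{F},\mathbb{P})$, $\mathcal{G}\subseteq\mathcal{F}$ a sigma-field and $\lambda\in(0,1)$. A random variable $Q_\lambda$ is called (a version of) a conditional $\lambda$th quantile of $X$ with respect to $\mathcal{G}$, denoted $\pi_\lambda(X|\mathcal{G})$, if (i) $Q_\lambda$ is $\mathcal{G}$-measurable and (ii) $\mathbb{P}(X\ge Q_\lambda|\mathcal{G})\ge 1-\lambda$ and $\mathbb{P}(X\le Q_\lambda|\mathcal{G})\ge\lambda$ almost surely. At least one version always exists. $\pi_\lambda(X|\mathcal{G})$ is called unique if any two versions of it are almost surely equal. Invariant sets: a set $A\in\mathcal{F}$ is called invariant with respect to $\mathbb{X}=(X_n,n\ge1)$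 if there exists $B\in\mathcal{B}(\mathbb{R}^{\mathbb{N}})$ (Borel sigma-field of the space $\mathbb{R}^{\mathbb{N}}$ of real sequences, $\mathbb{N}=\{1,2,\ldots\}$) such that $A=\{\omega\in\Omega: (X_i(\omega),X_{i+1}(\omega),\ldots)\in B\}$ for every $i\ge 1$. $\mathcal{I}^{\mathbb{X}}$ denotes the collection of all such sets; it is a sigma-field. *)

theory Defs
  imports "HOL-Probability.Probability"
begin

text \<open>Sequences \<open>X\<^sub>1, X\<^sub>2, \<dots>\<close> are functions \<open>X :: nat \<Rightarrow> 'a \<Rightarrow> real\<close> of which only the
  values at indices \<open>\<ge> 1\<close> are used; \<open>X 0\<close> is irrelevant throughout.\<close>

definition strictly_stationary :: "'a measure \<Rightarrow> (nat \<Rightarrow> 'a \<Rightarrow> real) \<Rightarrow> bool" where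
  "strictly_stationary M X \<longleftrightarrow>
    (\<forall>J h. finite J \<longrightarrow> J \<subseteq> {1..} \<longrightarrow>
      distr M (Pi\<^sub>M J (\<lambda>_. borel)) (\<lambda>\<omega>. \<lambda>i\<in>J. X (i + h) \<omega>) =
      distr M (Pi\<^sub>M J (\<lambda>_. borel)) (\<lambda>\<omega>. \<lambda>i\<in>J. X i \<omega>))"

text \<open>\<open>order_stat X k n \<omega>\<close> is \<open>X\<^bsub>k:n\<^esub>(\<omega>)\<close>, meaningful for \<open>1 \<le> k \<le> n\<close>; list positions start
  at 0, hence \<open>k - 1\<close>.\<close>

definition order_stat :: "(nat \<Rightarrow> 'a \<Rightarrow> real) \<Rightarrow> nat \<Rightarrow> nat \<Rightarrow> 'a \<Rightarrow> real" where
  "order_stat X k n \<omega> = sort (map (\<lambda>i. X i \<omega>) [1..<Suc n]) ! (k - 1)"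

text \<open>As in the library's theory of conditional expectations, a sub-sigma-field is given as a
  measure \<open>G\<close> with \<open>subalgebra M G\<close>; only \<open>space G\<close> and \<open>sets G\<close> matter.\<close>

definition cond_prob_given :: "'a measure \<Rightarrow> 'a measure \<Rightarrow> ('a \<Rightarrow> bool) \<Rightarrow> 'a \<Rightarrow> real" where
  "cond_prob_given M G P = real_cond_exp M G (indicator {\<omega> \<in> space M. P \<omega>})"

definition is_cond_quantile ::
  "'a measure \<Rightarrow> 'a measure \<Rightarrow> real \<Rightarrow> ('a \<Rightarrow> real) \<Rightarrow> ('a \<Rightarrow> real) \<Rightarrow> bool" where
  "is_cond_quantile M G lam X Q \<longleftrightarrow>
    Q \<in> borel_measurable G \<and>
    (AE \<omega> in M. cond_prob_given M G (\<lambda>\<omega>'. X \<omega>' \<ge> Q \<omega>') \<omega> \<ge> 1 - lam) \<and>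
    (AE \<omega> in M. cond_prob_given M G (\<lambda>\<omega>'. X \<omega>' \<le> Q \<omega>') \<omega> \<ge> lam)"

definition cond_quantile_unique ::
  "'a measure \<Rightarrow> 'a measure \<Rightarrow> real \<Rightarrow> ('a \<Rightarrow> real) \<Rightarrow> bool" where
  "cond_quantile_unique M G lam X \<longleftrightarrow>
    (\<forall>Q Q'. is_cond_quantile M G lam X Q \<longrightarrow> is_cond_quantile M G lam X Q' \<longrightarrow>
      (AE \<omega> in M. Q \<omega> = Q' \<omega>))"

text \<open>The tail \<open>(X\<^sub>i, X\<^bsub>i+1\<^esub>, \<dots>)\<close> is the point \<open>\<lambda>j. X (i + j) \<omega>\<close> of the space of real sequences,
  whose coordinates are counted from 0 here; \<open>borel\<close> is taken for the product topology.\<close>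

definition invariant_sets :: "'a measure \<Rightarrow> (nat \<Rightarrow> 'a \<Rightarrow> real) \<Rightarrow> 'a set set" where
  "invariant_sets M X =
    {A \<in> sets M. \<exists>B \<in> sets (borel :: (nat \<Rightarrow> real) measure).
       \<forall>i\<ge>1. A = {\<omega> \<in> space M. (\<lambda>j. X (i + j) \<omega>) \<in> B}}"

definition invariant_algebra :: "'a measure \<Rightarrow> (nat \<Rightarrow> 'a \<Rightarrow> real) \<Rightarrow> 'a measure" where
  "invariant_algebra M X = sigma (space M) (invariant_sets M X)"

text \<open>The invariant sets already form a sigma-field, so \<open>sigma\<close> adds no sets.\<close>

lemma sigma_algebra_invariant_sets: "sigma_algebra (space M) (invariant_sets M X)"
  unfolding sigma_algebra_iff2
proof (intro conjI ballI allI impI)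
  show "invariant_sets M X \<subseteq> Pow (space M)"
    using sets.sets_into_space by (auto simp: invariant_sets_def)
  show "{} \<in> invariant_sets M X"
    unfolding invariant_sets_def by (auto intro!: bexI[of _ "{}"])
next
  fix A assume "A \<in> invariant_sets M X"
  then obtain B where "A \<in> sets M" "B \<in> sets (borel :: (nat \<Rightarrow> real) measure)"
    and "\<forall>i\<ge>1. A = {\<omega> \<in> space M. (\<lambda>j. X (i + j) \<omega>) \<in> B}"
    by (auto simp: invariant_sets_def)
  then show "space M - A \<in> invariant_sets M X"
    unfolding invariant_sets_def by (auto intro!: bexI[of _ "- B"])
next
  fix A :: "nat \<Rightarrow> 'a set" assume *: "range A \<subseteq> invariant_sets M X"
  then have "\<forall>n. \<exists>B. A n \<in> sets M \<and> B \<in> sets (borel :: (nat \<Rightarrow> real) measure) \<and>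
      (\<forall>i\<ge>1. A n = {\<omega> \<in> space M. (\<lambda>j. X (i + j) \<omega>) \<in> B})"
    unfolding invariant_sets_def by blast
  then obtain B where B: "\<And>n. A n \<in> sets M" "\<And>n. B n \<in> sets (borel :: (nat \<Rightarrow> real) measure)"
    "\<And>n i. i \<ge> 1 \<Longrightarrow> A n = {\<omega> \<in> space M. (\<lambda>j. X (i + j) \<omega>) \<in> B n}"
    by metis
  have "(\<Union>n. A n) = {\<omega> \<in> space M. (\<lambda>j. X (i + j) \<omega>) \<in> (\<Union>n. B n)}" if "i \<ge> 1" for i
    using B(3)[OF that] by auto
  moreover have "(\<Union>n. A n) \<in> sets M" "(\<Union>n. B n) \<in> sets borel"
    using B(1,2) by auto
  ultimately show "(\<Union>n. A n) \<in> invariant_sets M X"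
    unfolding invariant_sets_def by blast
qed

lemma space_invariant_algebra: "space (invariant_algebra M X) = space M"
  by (simp add: invariant_algebra_def space_measure_of_conv)

lemma sets_invariant_algebra: "sets (invariant_algebra M X) = invariant_sets M X"
  unfolding invariant_algebra_def
  by (rule sigma_algebra.sets_measure_of_eq[OF sigma_algebra_invariant_sets])

lemma subalgebra_invariant_algebra: "subalgebra M (invariant_algebra M X)"
  by (auto simp: subalgebra_def space_invariant_algebra sets_invariant_algebra invariant_sets_def)

end

theory Submission
  imports Defs
begin

text \<open>Birkhoff's theorem for bounded \<open>f\<close> is obtained from the maximal inequality. On an invariant
  set \<open>D\<close> on which \<open>E(f X\<^sub>1 | I) < a < b\<close> and the sums of \<open>f X\<^sub>i - b\<close> are unbounded above, it gives
  \<open>0 \<le> (a - b) P(D)\<close>, so \<open>D\<close> is null and the limes superior of the averages is at most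
  \<open>E(f X\<^sub>1 | I)\<close>; then pass to \<open>-f\<close>. Consequently the empirical distribution function at each
  rational \<open>q\<close> tends to \<open>P(X\<^sub>1 \<le> q | I)\<close>. Uniqueness of the quantile \<open>Q\<close> forces this limit to be
  strictly below \<open>lam\<close> for \<open>q < Q\<close> and strictly above it for \<open>q > Q\<close>, and \<open>X\<^bsub>k:n\<^esub> \<le> q\<close> says exactly
  that the empirical distribution function at \<open>q\<close> is at least \<open>k / n\<close>.\<close>

section \<open>Functionals on sequence space: maximal partial sums and unbounded sums\<close>

text \<open>The maximum of \<open>0\<close> and the first \<open>n\<close> partial sums, in the recursive form that the proof of
  the maximal inequality exploits.\<close>

primrec max_partial_sum :: "(real \<Rightarrow> real) \<Rightarrow> nat \<Rightarrow> (nat \<Rightarrow> real) \<Rightarrow> real" where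
  "max_partial_sum f 0 x = 0"
| "max_partial_sum f (Suc n) x = max 0 (f (x 0) + max_partial_sum f n (\<lambda>j. x (Suc j)))"

lemma max_partial_sum_nonneg: "0 \<le> max_partial_sum f n x"
  by (cases n) auto

lemma max_partial_sum_mono_Suc: "max_partial_sum f n x \<le> max_partial_sum f (Suc n) x"
proof (induction n arbitrary: x)
  case (Suc n)
  from Suc[of "\<lambda>j. x (Suc j)"] show ?case by auto
qed simp

lemma sum_le_max_partial_sum: "(\<Sum>j<n. f (x j)) \<le> max_partial_sum f n x"
proof (induction n arbitrary: x)
  case (Suc n)
  from Suc[of "\<lambda>j. x (Suc j)"] show ?case
    by (simp add: sum.lessThan_Suc_shift del: sum.lessThan_Suc)
qed simp

text \<open>Boundedness makes the maxima integrable over a probability space, so their integrals may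
  be subtracted.\<close>

lemma max_partial_sum_le:
  assumes "\<And>t. \<bar>f t\<bar> \<le> C"
  shows "max_partial_sum f n x \<le> real n * C"
proof (induction n arbitrary: x)
  case (Suc n)
  have "f (x 0) \<le> C" "0 \<le> C" using assms[of "x 0"] by auto
  moreover have "0 \<le> real n * C" using \<open>0 \<le> C\<close> by simp
  ultimately show ?case
    using Suc[of "\<lambda>j. x (Suc j)"] by (simp add: algebra_simps)
qed simp

lemma measurable_coordinate_shift:
  "(\<lambda>x j. x (i + j)) \<in> borel_measurable (borel :: (nat \<Rightarrow> real) measure)"
  by (intro measurable_coordinatewise_then_product) simp

lemma borel_measurable_max_partial_sum:
  assumes [measurable]: "f \<in> borel_measurable borel"
  shows "max_partial_sum f n \<in> borel_measurable borel"
proof (induction n)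
  case (Suc n)
  have [measurable]: "(\<lambda>x. max_partial_sum f n (\<lambda>j. x (Suc j))) \<in> borel_measurable borel"
    using measurable_compose[OF measurable_coordinate_shift[of 1] Suc] by simp
  show ?case by simp
qed simp

text \<open>With \<open>f - b\<close> in place of \<open>f\<close>, this is the event on which the
  averages of \<open>f\<close> may exceed \<open>b\<close>: off it they are at most
  \<open>b + K / n\<close> for a fixed \<open>K\<close>. Natural thresholds keep all quantifiers
  countable, hence the set Borel.\<close>

definition unbounded_sums :: "(real \<Rightarrow> real) \<Rightarrow> (nat \<Rightarrow> real) set" where
  "unbounded_sums f = {x. \<forall>K::nat. \<exists>n. real K < (\<Sum>j<n. f (x j))}"

lemma unbounded_sums_measurable:
  assumes [measurable]: "f \<in> borel_measurable borel"
  shows "unbounded_sums f \<in> sets borel"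
  unfolding unbounded_sums_def by measurable

text \<open>Dropping the first term changes a partial sum by at most \<open>C\<close>, which is
  absorbed by raising the threshold from \<open>K\<close> to \<open>K + N\<close> with
  \<open>C < N\<close>.\<close>

lemma unbounded_sums_Suc:
  assumes "\<And>t. \<bar>f t\<bar> \<le> C"
  shows "(\<lambda>j. x (Suc j)) \<in> unbounded_sums f \<longleftrightarrow> x \<in> unbounded_sums f"
proof -
  have sum_Suc: "(\<Sum>j<Suc n. f (x j)) = f (x 0) + (\<Sum>j<n. f (x (Suc j)))" for n
    by (rule sum.lessThan_Suc_shift)
  obtain N :: nat where N: "C < N" using reals_Archimedean2 by blast
  have f: "f (x 0) < N" "- f (x 0) < N" using assms[of "x 0"] N by auto
  show ?thesis
  proof
    assume *: "(\<lambda>j. x (Suc j)) \<in> unbounded_sums f"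
    show "x \<in> unbounded_sums f"
      unfolding unbounded_sums_def
    proof safe
      fix K
      obtain n where "real (K + N) < (\<Sum>j<n. f (x (Suc j)))"
        using * unfolding unbounded_sums_def by blast
      then have "real K < (\<Sum>j<Suc n. f (x j))" unfolding sum_Suc using f by simp
      then show "\<exists>n. real K < (\<Sum>j<n. f (x j))" by blast
    qed
  next
    assume *: "x \<in> unbounded_sums f"
    show "(\<lambda>j. x (Suc j)) \<in> unbounded_sums f"
      unfolding unbounded_sums_def
    proof safe
      fix K
      obtain n where n: "real (K + N) < (\<Sum>j<n. f (x j))"
        using * unfolding unbounded_sums_def by blast
      \<comment> \<open>The empty sum cannot exceed a nonnegative threshold, so there is a first
        term to split off.\<close>
      then have "n \<noteq> 0" by (intro notI) simp
      then obtain m where "n = Suc m" by (cases n) auto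
      with n have "real (K + N) < f (x 0) + (\<Sum>j<m. f (x (Suc j)))" by (simp only: sum_Suc)
      then have "real K < (\<Sum>j<m. f (x (Suc j)))" using f by simp
      then show "\<exists>n. real K < (\<Sum>j<n. f (x (Suc j)))" by blast
    qed
  qed
qed

lemma unbounded_sums_shift:
  assumes "\<And>t. \<bar>f t\<bar> \<le> C"
  shows "(\<lambda>j. x (i + j)) \<in> unbounded_sums f \<longleftrightarrow> x \<in> unbounded_sums f"
proof (induction i)
  case (Suc i)
  then show ?case using unbounded_sums_Suc[where f = f and x = "\<lambda>j. x (i + j)", OF assms] by simp
qed simp

section \<open>Stationary sequences and the ergodic theorem for bounded functions\<close>

locale stationary_sequence = prob_space M for M :: "'a measure" +
  fixes X :: "nat \<Rightarrow> 'a \<Rightarrow> real"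
  assumes measurable_X: "n \<ge> 1 \<Longrightarrow> X n \<in> borel_measurable M"
    and stationary: "strictly_stationary M X"
begin

abbreviation "G \<equiv> invariant_algebra M X"

sublocale G: finite_measure_subalgebra M G
  by unfold_locales (rule subalgebra_invariant_algebra)

lemma measurable_tail:
  assumes "i \<ge> 1"
  shows "(\<lambda>\<omega> j. X (i + j) \<omega>) \<in> borel_measurable M"
  using assms by (intro measurable_coordinatewise_then_product measurable_X) auto

text \<open>Finite-dimensional boxes determine a finite measure on sequence space, and stationarity
  with shift 1 equates the two laws on every box.\<close>

lemma tail_distr:
  "distr M borel (\<lambda>\<omega> j. X (Suc (Suc j)) \<omega>) = distr M borel (\<lambda>\<omega> j. X (Suc j) \<omega>)"
proof (rule measure_eqI_PiM_infinite[where I = UNIV and M = "\<lambda>_. borel"])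
  let ?D = "\<lambda>h. distr M borel (\<lambda>\<omega> j. X (Suc (j + h)) \<omega>)"
  have meas: "(\<lambda>\<omega> j. X (Suc (j + h)) \<omega>) \<in> borel_measurable M" for h
    using measurable_tail[of "Suc h"] by (simp add: add.commute)
  show "sets (distr M borel (\<lambda>\<omega> j. X (Suc (Suc j)) \<omega>)) = sets (Pi\<^sub>M UNIV (\<lambda>_. borel))"
    "sets (distr M borel (\<lambda>\<omega> j. X (Suc j) \<omega>)) = sets (Pi\<^sub>M UNIV (\<lambda>_. borel))"
    by (simp_all add: sets_PiM_equal_borel)
  show "finite_measure (distr M borel (\<lambda>\<omega> j. X (Suc (Suc j)) \<omega>))"
    using meas[of 1] by (intro finite_measure_distr) simp
  fix A :: "nat \<Rightarrow> real set" and J :: "nat set"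
  assume J: "finite J" and A: "\<And>j. j \<in> J \<Longrightarrow> A j \<in> sets borel"
  \<comment> \<open>Coordinates of a tail count from 0, while stationarity concerns indices from 1
    on; \<open>Suc\<close> translates one into the other. Below, \<open>h = 0\<close> and
    \<open>h = 1\<close> are the two tails to be compared.\<close>
  let ?J = "Suc ` J"
  let ?B = "\<Pi>\<^sub>E i\<in>?J. A (i - 1)"
  have box: "emeasure (?D h) (prod_emb UNIV (\<lambda>_. borel) J (Pi\<^sub>E J A)) =
      emeasure (distr M (Pi\<^sub>M ?J (\<lambda>_. borel)) (\<lambda>\<omega>. \<lambda>i\<in>?J. X (i + h) \<omega>)) ?B" for h
  proof -
    have E: "prod_emb UNIV (\<lambda>_. borel) J (Pi\<^sub>E J A) \<in> sets (borel :: (nat \<Rightarrow> real) measure)"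
      using sets_PiM_I[of J UNIV A "\<lambda>_. borel"] J A unfolding sets_PiM_equal_borel by blast
    have m: "(\<lambda>\<omega>. \<lambda>i\<in>?J. X (i + h) \<omega>) \<in> measurable M (Pi\<^sub>M ?J (\<lambda>_. borel))"
      by (intro measurable_restrict measurable_X) auto
    have B: "?B \<in> sets (Pi\<^sub>M ?J (\<lambda>_. borel))"
      using J A by (intro sets_PiM_I_finite) auto
    have emb: "x \<in> prod_emb UNIV (\<lambda>_. borel) J (Pi\<^sub>E J A) \<longleftrightarrow> (\<forall>j\<in>J. x j \<in> A j)" for x
      by (simp add: prod_emb_iff PiE_iff)
    have box: "(\<lambda>i\<in>?J. X (i + h) \<omega>) \<in> ?B \<longleftrightarrow> (\<forall>j\<in>J. X (Suc (j + h)) \<omega> \<in> A j)" for \<omega>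
      by (simp add: PiE_iff)
    have "(\<lambda>\<omega> j. X (Suc (j + h)) \<omega>) -` prod_emb UNIV (\<lambda>_. borel) J (Pi\<^sub>E J A) \<inter> space M =
        (\<lambda>\<omega>. \<lambda>i\<in>?J. X (i + h) \<omega>) -` ?B \<inter> space M"
      by (intro set_eqI) (simp only: vimage_eq Int_iff emb box)
    then show ?thesis
      by (simp only: emeasure_distr[OF meas E] emeasure_distr[OF m B])
  qed
  have "distr M (Pi\<^sub>M ?J (\<lambda>_. borel)) (\<lambda>\<omega>. \<lambda>i\<in>?J. X (i + 1) \<omega>) =
      distr M (Pi\<^sub>M ?J (\<lambda>_. borel)) (\<lambda>\<omega>. \<lambda>i\<in>?J. X (i + 0) \<omega>)"
    using stationary[unfolded strictly_stationary_def, rule_format, of ?J 1] J by auto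
  then show "emeasure (distr M borel (\<lambda>\<omega> j. X (Suc (Suc j)) \<omega>))
        (prod_emb UNIV (\<lambda>_. borel) J (Pi\<^sub>E J A)) =
      emeasure (distr M borel (\<lambda>\<omega> j. X (Suc j) \<omega>)) (prod_emb UNIV (\<lambda>_. borel) J (Pi\<^sub>E J A))"
    using box[of 1] box[of 0] by simp
qed

text \<open>An invariant \<open>D\<close> is the preimage of one Borel set \<open>B\<close> under
  every tail. Both sides are therefore integrals of the same function
  \<open>indicator B x * h x\<close>, against laws that agree by \<open>tail_distr\<close>.\<close>

lemma integral_tail_shift:
  fixes h :: "(nat \<Rightarrow> real) \<Rightarrow> real"
  assumes D: "D \<in> sets G" and h: "h \<in> borel_measurable borel"
  shows "(\<integral>\<omega>. indicator D \<omega> * h (\<lambda>j. X (Suc (Suc j)) \<omega>) \<partial>M) =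
    (\<integral>\<omega>. indicator D \<omega> * h (\<lambda>j. X (Suc j) \<omega>) \<partial>M)"
proof -
  obtain B where B: "B \<in> sets borel"
    and D_eq: "\<And>i. i \<ge> 1 \<Longrightarrow> D = {\<omega> \<in> space M. (\<lambda>j. X (i + j) \<omega>) \<in> B}"
    using D by (auto simp: sets_invariant_algebra invariant_sets_def)
  have push: "(\<integral>\<omega>. indicator D \<omega> * h (\<lambda>j. X (i + j) \<omega>) \<partial>M) =
      (\<integral>x. indicator B x * h x \<partial>distr M borel (\<lambda>\<omega> j. X (i + j) \<omega>))" if "i \<ge> 1" for i
  proof -
    have "(\<integral>x. indicator B x * h x \<partial>distr M borel (\<lambda>\<omega> j. X (i + j) \<omega>)) =
        (\<integral>\<omega>. indicator B (\<lambda>j. X (i + j) \<omega>) * h (\<lambda>j. X (i + j) \<omega>) \<partial>M)"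
      using measurable_tail[OF that] B h by (intro integral_distr) auto
    also have "\<dots> = (\<integral>\<omega>. indicator D \<omega> * h (\<lambda>j. X (i + j) \<omega>) \<partial>M)"
      using D_eq[OF that] by (intro Bochner_Integration.integral_cong) (auto simp: indicator_def)
    finally show ?thesis ..
  qed
  show ?thesis using push[of 1] push[of 2] tail_distr by simp
qed

text \<open>Garsia's argument: where the maximum of the partial sums is positive,
  \<open>f (X 1 \<omega>)\<close> dominates the maximum minus its shift, and this difference
  integrates to 0 over an invariant set. Under \<open>pos\<close> the places with positive maximum
  exhaust \<open>D\<close>.\<close>

lemma maximal_ergodic:
  fixes f :: "real \<Rightarrow> real"
  assumes f: "f \<in> borel_measurable borel" and C: "\<And>t. \<bar>f t\<bar> \<le> C"
    and D: "D \<in> sets G"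
    and pos: "\<And>\<omega>. \<omega> \<in> D \<Longrightarrow> \<exists>n. 0 < (\<Sum>j<n. f (X (Suc j) \<omega>))"
  shows "0 \<le> (\<integral>\<omega>. indicator D \<omega> * f (X 1 \<omega>) \<partial>M)"
proof -
  note [measurable] = f
  have [measurable]: "D \<in> sets M"
    using D subalgebra_invariant_algebra[of M X] by (auto simp: subalgebra_def)
  \<comment> \<open>The functional on the tail starting at \<open>X i\<close>; \<open>m 2 n\<close>
    is the shift of \<open>m 1 n\<close>.\<close>
  define m where "m i n \<omega> = max_partial_sum f n (\<lambda>j. X (i + j) \<omega>)" for i n \<omega>
  have meas: "m i n \<in> borel_measurable M" if "i \<ge> 1" for i n
    unfolding m_def
    by (rule measurable_compose[OF measurable_tail[OF that] borel_measurable_max_partial_sum[OF f]])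
  have [measurable]: "m 1 n \<in> borel_measurable M" for n
    by (rule meas) simp
  have [measurable]: "X 1 \<in> borel_measurable M" "X (Suc 0) \<in> borel_measurable M"
    by (simp_all add: measurable_X)
  have m_nonneg: "0 \<le> m i n \<omega>" for i n \<omega> unfolding m_def by (rule max_partial_sum_nonneg)
  have m_le: "m i n \<omega> \<le> real n * C" for i n \<omega> unfolding m_def by (rule max_partial_sum_le[OF C])
  have m_Suc: "m 1 (Suc n) \<omega> = max 0 (f (X 1 \<omega>) + m 2 n \<omega>)" for n \<omega>
    by (simp add: m_def)
  have m_mono: "m i n \<omega> \<le> m i (Suc n) \<omega>" for i n \<omega>
    unfolding m_def by (rule max_partial_sum_mono_Suc)
  have C_nonneg: "0 \<le> C" using order_trans[OF abs_ge_zero C] .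
  have int: "integrable M (\<lambda>\<omega>. indicator D \<omega> * m i n \<omega>)" if "i \<ge> 1" for i n
  proof (rule integrable_const_bound[of _ "real n * C"])
    show "AE \<omega> in M. norm (indicator D \<omega> * m i n \<omega>) \<le> real n * C"
      by (rule AE_I2) (simp add: indicator_def m_nonneg m_le C_nonneg)
    show "(\<lambda>\<omega>. indicator D \<omega> * m i n \<omega>) \<in> borel_measurable M"
      using meas[OF that] by simp
  qed
  define E where "E n = {\<omega> \<in> space M. 0 < m 1 n \<omega>}" for n
  have [measurable]: "E n \<in> sets M" for n unfolding E_def by measurable
  have int_f: "integrable M (\<lambda>\<omega>. indicator D \<omega> * (indicator (E n) \<omega> * f (X 1 \<omega>)))" for n
    by (rule integrable_const_bound[of _ C]) (simp_all add: indicator_def C C_nonneg)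
  have nonneg: "0 \<le> (\<integral>\<omega>. indicator D \<omega> * (indicator (E (Suc n)) \<omega> * f (X 1 \<omega>)) \<partial>M)" for n
  proof -
    have "0 = (\<integral>\<omega>. indicator D \<omega> * m 1 n \<omega> \<partial>M) - (\<integral>\<omega>. indicator D \<omega> * m 2 n \<omega> \<partial>M)"
      using integral_tail_shift[OF D borel_measurable_max_partial_sum[OF f, of n]]
      by (simp add: m_def)
    also have "\<dots> = (\<integral>\<omega>. indicator D \<omega> * m 1 n \<omega> - indicator D \<omega> * m 2 n \<omega> \<partial>M)"
      by (simp add: int)
    \<comment> \<open>On \<open>E (Suc n)\<close> the recursion reads
      \<open>m 1 (Suc n) = f (X 1) + m 2 n\<close>, so monotonicity gives
      \<open>f (X 1) \<ge> m 1 n - m 2 n\<close>. Off it \<open>m 1 n = 0\<close>, and the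
      difference is at most 0.\<close>
    also have "\<dots> \<le> (\<integral>\<omega>. indicator D \<omega> * (indicator (E (Suc n)) \<omega> * f (X 1 \<omega>)) \<partial>M)"
    proof (rule integral_mono[OF Bochner_Integration.integrable_diff[OF int int] int_f])
      fix \<omega> assume "\<omega> \<in> space M"
      then show "indicator D \<omega> * m 1 n \<omega> - indicator D \<omega> * m 2 n \<omega>
          \<le> indicator D \<omega> * (indicator (E (Suc n)) \<omega> * f (X 1 \<omega>))"
        using m_mono[of 1 n \<omega>] m_nonneg[of 1 n \<omega>] m_nonneg[of 2 n \<omega>] m_Suc[of n \<omega>]
        by (cases "\<omega> \<in> D"; cases "0 < m 1 (Suc n) \<omega>")
          (simp_all add: E_def max_def del: One_nat_def split: if_splits)
    qed (simp_all add: int)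
    finally show ?thesis .
  qed
  \<comment> \<open>The maxima increase in \<open>n\<close> and dominate the partial sums, so each
    point of \<open>D\<close> lies in \<open>E (Suc n)\<close> for all large \<open>n\<close>; the
    constant \<open>C\<close> dominates.\<close>
  have "(\<lambda>n. \<integral>\<omega>. indicator D \<omega> * (indicator (E (Suc n)) \<omega> * f (X 1 \<omega>)) \<partial>M)
      \<longlonglongrightarrow> (\<integral>\<omega>. indicator D \<omega> * f (X 1 \<omega>) \<partial>M)"
  proof (rule integral_dominated_convergence[where w = "\<lambda>_. C"])
    show "AE \<omega> in M. (\<lambda>n. indicator D \<omega> * (indicator (E (Suc n)) \<omega> * f (X 1 \<omega>)))
        \<longlonglongrightarrow> indicator D \<omega> * f (X 1 \<omega>)"
    proof (rule AE_I2)
      fix \<omega> assume \<omega>: "\<omega> \<in> space M"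
      show "(\<lambda>n. indicator D \<omega> * (indicator (E (Suc n)) \<omega> * f (X 1 \<omega>)))
          \<longlonglongrightarrow> indicator D \<omega> * f (X 1 \<omega>)"
      proof (cases "\<omega> \<in> D")
        case True
        then obtain N where N: "0 < (\<Sum>j<N. f (X (Suc j) \<omega>))" using pos[OF True] by blast
        have "\<omega> \<in> E (Suc n)" if "n \<ge> N" for n
        proof -
          have "(\<Sum>j<N. f (X (Suc j) \<omega>)) \<le> m 1 N \<omega>"
            using sum_le_max_partial_sum[of f "\<lambda>j. X (Suc j) \<omega>" N] by (simp add: m_def)
          also have "\<dots> \<le> m 1 (Suc n) \<omega>"
            using that by (intro lift_Suc_mono_le[of "\<lambda>n. m 1 n \<omega>", OF m_mono]) simp
          finally show ?thesis using N \<omega> by (simp add: E_def)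
        qed
        then show ?thesis
          by (intro tendsto_eventually eventually_sequentiallyI[of N]) simp
      qed simp
    qed
    show "AE \<omega> in M. norm (indicator D \<omega> * (indicator (E (Suc n)) \<omega> * f (X 1 \<omega>))) \<le> C" for n
      by (rule AE_I2) (simp add: indicator_def C C_nonneg)
  qed measurable
  then show ?thesis by (rule LIMSEQ_le_const) (simp only: nonneg simp_thms)
qed

text \<open>The upper half of the ergodic theorem. The quantifier over \<open>c\<close> stands
  inside the almost-everywhere statement, so the exceptional null sets are collected over rational
  pairs \<open>a < b\<close> only.\<close>

lemma averages_eventually_less:
  assumes f: "f \<in> borel_measurable borel" and C: "\<And>t. \<bar>f t\<bar> \<le> C"
  shows "AE \<omega> in M. \<forall>c > real_cond_exp M G (\<lambda>\<omega>. f (X 1 \<omega>)) \<omega>.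
    \<forall>\<^sub>F n in sequentially. (\<Sum>j<n. f (X (Suc j) \<omega>)) / real n < c"
proof -
  define F where "F = real_cond_exp M G (\<lambda>\<omega>. f (X 1 \<omega>))"
  have F[measurable]: "F \<in> borel_measurable G" unfolding F_def by simp
  have [measurable]: "X 1 \<in> borel_measurable M" "X (Suc 0) \<in> borel_measurable M"
    by (simp_all add: measurable_X)
  note [measurable] = f
  have int_f: "integrable M (\<lambda>\<omega>. f (X 1 \<omega>))"
    by (rule integrable_const_bound[of _ C]) (use C in auto)
  have *: "AE \<omega> in M. F \<omega> < a \<longrightarrow> (\<lambda>j. X (Suc j) \<omega>) \<notin> unbounded_sums (\<lambda>t. f t - b)"
    if "a < b" for a b
  proof -
    let ?g = "\<lambda>t. f t - b"
    define D where "D = {\<omega> \<in> space M. F \<omega> < a \<and> (\<lambda>j. X (Suc j) \<omega>) \<in> unbounded_sums ?g}"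
    have g: "\<bar>?g t\<bar> \<le> C + \<bar>b\<bar>" for t using C[of t] by linarith
    have g_meas: "?g \<in> borel_measurable borel" by measurable
    \<comment> \<open>By shift invariance, the Borel set \<open>unbounded_sums ?g\<close> itself is
      a common witness for all tails.\<close>
    have U: "{\<omega> \<in> space M. (\<lambda>j. X (Suc j) \<omega>) \<in> unbounded_sums ?g} \<in> sets G"
    proof -
      have shift: "(\<lambda>j. X (i + j) \<omega>) \<in> unbounded_sums ?g \<longleftrightarrow>
          (\<lambda>j. X (Suc j) \<omega>) \<in> unbounded_sums ?g" if "i \<ge> 1" for i \<omega>
        using unbounded_sums_shift[of ?g, OF g, of "\<lambda>j. X (Suc j) \<omega>" "i - 1"] that by simp
      have "(\<lambda>\<omega> j. X (Suc j) \<omega>) \<in> borel_measurable M" using measurable_tail[of 1] by simp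
      then have "{\<omega> \<in> space M. (\<lambda>j. X (Suc j) \<omega>) \<in> unbounded_sums ?g} \<in> sets M"
        using unbounded_sums_measurable[OF g_meas] by measurable
      then show ?thesis
        unfolding sets_invariant_algebra invariant_sets_def
        using unbounded_sums_measurable[OF g_meas] shift by auto
    qed
    have "{\<omega> \<in> space G. F \<omega> < a} \<in> sets G" by measurable
    from sets.Int[OF this U] have D: "D \<in> sets G"
      by (simp add: D_def space_invariant_algebra Int_def conj_ac cong: conj_cong)
    then have D_M[measurable]: "D \<in> sets M"
      using subalgebra_invariant_algebra[of M X] by (auto simp: subalgebra_def)
    have int_D: "integrable M (\<lambda>\<omega>. indicator D \<omega> * c)" for c :: real
      by (rule integrable_const_bound[of _ "\<bar>c\<bar>"]) (auto simp: indicator_def)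
    have int_F: "integrable M F" unfolding F_def by (rule G.real_cond_exp_int(1)[OF int_f])
    have "0 \<le> (\<integral>\<omega>. indicator D \<omega> * ?g (X 1 \<omega>) \<partial>M)"
    proof (rule maximal_ergodic[OF g_meas g D])
      fix \<omega> assume "\<omega> \<in> D"
      \<comment> \<open>Threshold \<open>K = 0\<close> supplies the positive partial sum required by
        the maximal inequality.\<close>
      then have "\<exists>n. real 0 < (\<Sum>j<n. ?g (X (Suc j) \<omega>))"
        unfolding D_def unbounded_sums_def by blast
      then show "\<exists>n. 0 < (\<Sum>j<n. ?g (X (Suc j) \<omega>))" by simp
    qed
    also have "\<dots> = (\<integral>\<omega>. indicator D \<omega> * f (X 1 \<omega>) - indicator D \<omega> * b \<partial>M)"
      by (simp add: right_diff_distrib)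
    also have "\<dots> = (\<integral>\<omega>. indicator D \<omega> * f (X 1 \<omega>) \<partial>M) - (\<integral>\<omega>. indicator D \<omega> * b \<partial>M)"
      using integrable_real_mult_indicator[OF D_M int_f] int_D
      by (intro Bochner_Integration.integral_diff) (simp_all add: mult.commute)
    \<comment> \<open>Since \<open>D\<close> belongs to \<open>G\<close>, the conditional
      expectation has the same integral over it; next, \<open>F < a\<close> on \<open>D\<close>
      bounds that integral.\<close>
    also have "(\<integral>\<omega>. indicator D \<omega> * f (X 1 \<omega>) \<partial>M) = (\<integral>\<omega>. indicator D \<omega> * F \<omega> \<partial>M)"
      using G.real_cond_exp_intA[OF int_f D] unfolding F_def set_lebesgue_integral_def by simp
    also have "\<dots> \<le> (\<integral>\<omega>. indicator D \<omega> * a \<partial>M)"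
      using integrable_real_mult_indicator[OF D_M int_F] int_D
      by (intro integral_mono) (auto simp: mult.commute D_def split: split_indicator)
    finally have "0 \<le> (a - b) * prob D"
      by (simp add: algebra_simps)
    then have "prob D = 0"
      using that measure_nonneg[of M D] by (simp add: zero_le_mult_iff)
    then have "AE \<omega> in M. \<omega> \<notin> D" by (simp add: prob_eq_0)
    then show ?thesis by (auto simp: D_def)
  qed
  have "AE \<omega> in M. \<forall>a\<in>\<rat>. \<forall>b\<in>\<rat>. a < b \<longrightarrow> F \<omega> < a \<longrightarrow>
      (\<lambda>j. X (Suc j) \<omega>) \<notin> unbounded_sums (\<lambda>t. f t - b)"
    using * by (simp add: AE_ball_countable countable_rat)
  then show ?thesis
  proof (rule AE_mp, intro AE_I2 impI allI)
    fix \<omega> c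
    assume *: "\<forall>a\<in>\<rat>. \<forall>b\<in>\<rat>. a < b \<longrightarrow> F \<omega> < a \<longrightarrow>
        (\<lambda>j. X (Suc j) \<omega>) \<notin> unbounded_sums (\<lambda>t. f t - b)"
      and "c > real_cond_exp M G (\<lambda>\<omega>. f (X 1 \<omega>)) \<omega>"
    then have "F \<omega> < c" by (simp add: F_def)
    obtain b where b: "b \<in> \<rat>" "F \<omega> < b" "b < c" using Rats_dense_in_real[OF \<open>F \<omega> < c\<close>] by blast
    obtain a where a: "a \<in> \<rat>" "F \<omega> < a" "a < b" using Rats_dense_in_real[OF \<open>F \<omega> < b\<close>] by blast
    obtain K :: nat where K: "\<And>n. (\<Sum>j<n. f (X (Suc j) \<omega>) - b) \<le> K"
      using * a b unfolding unbounded_sums_def by (force simp: not_less)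
    \<comment> \<open>With the sums of \<open>f - b\<close> bounded by \<open>K\<close>, the average
      is at most \<open>b + K / n\<close>, which is below \<open>c\<close> once
      \<open>n > K / (c - b)\<close>.\<close>
    obtain N :: nat where N: "real K / (c - b) < N" using reals_Archimedean2 by blast
    show "\<forall>\<^sub>F n in sequentially. (\<Sum>j<n. f (X (Suc j) \<omega>)) / real n < c"
    proof (rule eventually_sequentiallyI[of "Suc N"])
      fix n assume n: "Suc N \<le> n"
      have "real K / (c - b) < n" using N n by linarith
      then have "real K < n * (c - b)" using b by (simp add: divide_less_eq)
      moreover have "(\<Sum>j<n. f (X (Suc j) \<omega>)) \<le> K + n * b" using K[of n] by (simp add: sum_subtractf)
      ultimately show "(\<Sum>j<n. f (X (Suc j) \<omega>)) / real n < c"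
        using n by (simp add: divide_less_eq algebra_simps)
    qed
  qed
qed

theorem birkhoff_bounded:
  assumes f: "f \<in> borel_measurable borel" and C: "\<And>t. \<bar>f t\<bar> \<le> C"
  shows "AE \<omega> in M. (\<lambda>n. (\<Sum>j<n. f (X (Suc j) \<omega>)) / real n)
    \<longlonglongrightarrow> real_cond_exp M G (\<lambda>\<omega>. f (X 1 \<omega>)) \<omega>"
proof -
  have [measurable]: "X 1 \<in> borel_measurable M" "X (Suc 0) \<in> borel_measurable M"
    by (simp_all add: measurable_X)
  note [measurable] = f
  have int_f: "integrable M (\<lambda>\<omega>. f (X 1 \<omega>))"
    by (rule integrable_const_bound[of _ C]) (use C in auto)
  \<comment> \<open>The sign leaves the conditional expectation only up to a null set, hence a
    separate almost-sure fact.\<close>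
  have neg: "AE \<omega> in M. real_cond_exp M G (\<lambda>\<omega>. - f (X 1 \<omega>)) \<omega> =
      - real_cond_exp M G (\<lambda>\<omega>. f (X 1 \<omega>)) \<omega>"
    using G.real_cond_exp_cmult[OF int_f, of "-1"] by simp
  have "AE \<omega> in M. \<forall>c > real_cond_exp M G (\<lambda>\<omega>. - f (X 1 \<omega>)) \<omega>.
    \<forall>\<^sub>F n in sequentially. (\<Sum>j<n. - f (X (Suc j) \<omega>)) / real n < c"
    by (rule averages_eventually_less[where C = C]) (use C in auto)
  with neg averages_eventually_less[OF f C] show ?thesis
  proof eventually_elim
    case (elim \<omega>)
    show ?case
    proof (rule order_tendstoI)
      fix c assume "c < real_cond_exp M G (\<lambda>\<omega>. f (X 1 \<omega>)) \<omega>"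
      then have "\<forall>\<^sub>F n in sequentially. (\<Sum>j<n. - f (X (Suc j) \<omega>)) / real n < - c"
        using elim by simp
      then show "\<forall>\<^sub>F n in sequentially. c < (\<Sum>j<n. f (X (Suc j) \<omega>)) / real n"
        by (simp add: sum_negf)
    qed (use elim in blast)
  qed
qed

end

section \<open>Order statistics by counting\<close>

lemma nth_le_iff_less_length_filter:
  fixes q :: "'a :: linorder"
  assumes "sorted xs" "i < length xs"
  shows "xs ! i \<le> q \<longleftrightarrow> i < length (filter (\<lambda>x. x \<le> q) xs)"
  using assms
proof (induction xs arbitrary: i)
  case (Cons a xs)
  show ?case
  proof (cases "a \<le> q")
    case True
    then show ?thesis using Cons by (cases i) auto
  next
    case False
    then have "\<forall>x\<in>set (a # xs). \<not> x \<le> q" using Cons.prems by auto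
    moreover from this have "filter (\<lambda>x. x \<le> q) (a # xs) = []" by (simp only: filter_empty_conv)
    ultimately show ?thesis using Cons.prems(2) nth_mem[of i "a # xs"] by auto
  qed
qed simp

text \<open>In a sorted list the values at most \<open>q\<close> form an initial segment, and
  sorting preserves their number. Position \<open>k - 1\<close> lies in this segment exactly when at
  least \<open>k\<close> sample values are at most \<open>q\<close>.\<close>

lemma order_stat_le_iff:
  assumes "1 \<le> k" "k \<le> n"
  shows "order_stat X k n \<omega> \<le> q \<longleftrightarrow> real k \<le> (\<Sum>j<n. indicator {..q} (X (Suc j) \<omega>))"
proof -
  let ?xs = "map (\<lambda>i. X i \<omega>) [1..<Suc n]"
  have "real (length (filter (\<lambda>x. x \<le> q) ?xs)) = (\<Sum>j<n. indicator {..q} (X (Suc j) \<omega>))"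
    by (induction n) (auto simp: indicator_def)
  moreover have "order_stat X k n \<omega> \<le> q \<longleftrightarrow> k - 1 < length (filter (\<lambda>x. x \<le> q) (sort ?xs))"
    unfolding order_stat_def using assms by (intro nth_le_iff_less_length_filter) auto
  moreover have "length (filter (\<lambda>x. x \<le> q) (sort ?xs)) = length (filter (\<lambda>x. x \<le> q) ?xs)"
    by (simp only: filter_sort length_sort)
  ultimately show ?thesis using assms(1) by linarith
qed

section \<open>Conditional probabilities and uniqueness of conditional quantiles\<close>

context finite_measure_subalgebra
begin

text \<open>Multiplying both events by \<open>indicator A\<close> makes the comparison global, and
  this factor, being \<open>F\<close>-measurable, pulls out of the conditional expectation.\<close>

lemma cond_prob_mono_on:
  assumes A: "A \<in> sets F"
    and P: "{\<omega> \<in> space M. P \<omega>} \<in> sets M" and R: "{\<omega> \<in> space M. R \<omega>} \<in> sets M"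
    and imp: "\<And>\<omega>. \<omega> \<in> A \<Longrightarrow> P \<omega> \<Longrightarrow> R \<omega>"
  shows "AE \<omega> in M. \<omega> \<in> A \<longrightarrow> cond_prob_given M F P \<omega> \<le> cond_prob_given M F R \<omega>"
proof -
  have A_M[measurable]: "A \<in> sets M" using A subalg by (auto simp: subalgebra_def)
  have A_F: "(indicator A :: 'a \<Rightarrow> real) \<in> borel_measurable F" using A by simp
  note [measurable] = P R
  have int: "integrable M (\<lambda>\<omega>. indicator A \<omega> * indicator S \<omega> :: real)" if [measurable]: "S \<in> sets M" for S
    by (rule integrable_const_bound[of _ 1]) (auto simp: indicator_def)
  have mono: "AE \<omega> in M. real_cond_exp M F (\<lambda>\<omega>. indicator A \<omega> * indicator {\<omega> \<in> space M. P \<omega>} \<omega>) \<omega> \<le>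
      real_cond_exp M F (\<lambda>\<omega>. indicator A \<omega> * indicator {\<omega> \<in> space M. R \<omega>} \<omega>) \<omega>"
    using imp by (intro real_cond_exp_mono int P R AE_I2) (auto simp: indicator_def)
  have mult: "AE \<omega> in M. real_cond_exp M F (\<lambda>\<omega>. indicator A \<omega> * indicator S \<omega>) \<omega> =
      indicator A \<omega> * real_cond_exp M F (indicator S) \<omega>" if S: "S \<in> sets M" for S
    using S by (intro real_cond_exp_mult[OF A_F _ int[OF S]]) simp
  from mono mult[OF P] mult[OF R] show ?thesis
  proof eventually_elim
    case (elim \<omega>)
    then show ?case by (cases "\<omega> \<in> A") (simp_all add: cond_prob_given_def)
  qed
qed

lemma cond_prob_not:
  assumes P: "{\<omega> \<in> space M. P \<omega>} \<in> sets M"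
  shows "AE \<omega> in M. cond_prob_given M F (\<lambda>\<omega>. \<not> P \<omega>) \<omega> = 1 - cond_prob_given M F P \<omega>"
proof -
  note [measurable] = P
  have meas: "(\<lambda>\<omega>. 1 - indicator {\<omega> \<in> space M. P \<omega>} \<omega> :: real) \<in> borel_measurable M"
    "(indicator {\<omega> \<in> space M. \<not> P \<omega>} :: 'a \<Rightarrow> real) \<in> borel_measurable M" by measurable
  have "AE \<omega> in M. cond_prob_given M F (\<lambda>\<omega>. \<not> P \<omega>) \<omega> =
      real_cond_exp M F (\<lambda>\<omega>. 1 - indicator {\<omega> \<in> space M. P \<omega>} \<omega>) \<omega>"
    unfolding cond_prob_given_def
    by (intro real_cond_exp_cong meas AE_I2) (auto simp: indicator_def)
  moreover have "AE \<omega> in M. real_cond_exp M F (\<lambda>\<omega>. 1 - indicator {\<omega> \<in> space M. P \<omega>} \<omega>) \<omega> =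
      real_cond_exp M F (\<lambda>_. 1) \<omega> - cond_prob_given M F P \<omega>"
    unfolding cond_prob_given_def
    by (intro real_cond_exp_diff integrable_const_bound[of _ 1] borel_measurable_indicator P AE_I2)
      (simp_all add: indicator_def)
  moreover have "AE \<omega> in M. real_cond_exp M F (\<lambda>_. 1) \<omega> = 1"
    by (intro real_cond_exp_F_meas) auto
  ultimately show ?thesis by eventually_elim simp
qed

text \<open>Pasting: on \<open>A\<close> the new function is \<open>q\<close> and off
  \<open>A\<close> it is \<open>Q\<close>, both sets being in \<open>F\<close>, so each quantile
  inequality is transferred separately on the two pieces.\<close>

lemma is_cond_quantile_If:
  assumes X[measurable]: "X \<in> borel_measurable M"
    and Q: "is_cond_quantile M F lam X Q" and A: "A \<in> sets F"
    and ge: "AE \<omega> in M. \<omega> \<in> A \<longrightarrow> 1 - lam \<le> cond_prob_given M F (\<lambda>\<omega>. q \<le> X \<omega>) \<omega>"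
    and le: "AE \<omega> in M. \<omega> \<in> A \<longrightarrow> lam \<le> cond_prob_given M F (\<lambda>\<omega>. X \<omega> \<le> q) \<omega>"
  shows "is_cond_quantile M F lam X (\<lambda>\<omega>. if \<omega> \<in> A then q else Q \<omega>)"
proof -
  let ?Q = "\<lambda>\<omega>. if \<omega> \<in> A then q else Q \<omega>"
  have Q_F: "Q \<in> borel_measurable F" using Q by (simp add: is_cond_quantile_def)
  have Q'_F: "?Q \<in> borel_measurable F" using A Q_F by (intro measurable_If_set) auto
  have [measurable]: "Q \<in> borel_measurable M" "?Q \<in> borel_measurable M"
    using Q_F Q'_F by (auto intro: measurable_from_subalg[OF subalg])
  have B: "space F - A \<in> sets F" using A by auto
  have sp: "\<omega> \<in> space F" if "\<omega> \<in> space M" for \<omega> using that subalg by (simp add: subalgebra_def)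
  have 1: "AE \<omega> in M. \<omega> \<in> A \<longrightarrow> cond_prob_given M F (\<lambda>\<omega>. q \<le> X \<omega>) \<omega> \<le>
      cond_prob_given M F (\<lambda>\<omega>. ?Q \<omega> \<le> X \<omega>) \<omega>"
    by (rule cond_prob_mono_on[OF A]) auto
  have 2: "AE \<omega> in M. \<omega> \<in> space F - A \<longrightarrow> cond_prob_given M F (\<lambda>\<omega>. Q \<omega> \<le> X \<omega>) \<omega> \<le>
      cond_prob_given M F (\<lambda>\<omega>. ?Q \<omega> \<le> X \<omega>) \<omega>"
    by (rule cond_prob_mono_on[OF B]) auto
  have 3: "AE \<omega> in M. \<omega> \<in> A \<longrightarrow> cond_prob_given M F (\<lambda>\<omega>. X \<omega> \<le> q) \<omega> \<le>
      cond_prob_given M F (\<lambda>\<omega>. X \<omega> \<le> ?Q \<omega>) \<omega>"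
    by (rule cond_prob_mono_on[OF A]) auto
  have 4: "AE \<omega> in M. \<omega> \<in> space F - A \<longrightarrow> cond_prob_given M F (\<lambda>\<omega>. X \<omega> \<le> Q \<omega>) \<omega> \<le>
      cond_prob_given M F (\<lambda>\<omega>. X \<omega> \<le> ?Q \<omega>) \<omega>"
    by (rule cond_prob_mono_on[OF B]) auto
  have Q_ge: "AE \<omega> in M. 1 - lam \<le> cond_prob_given M F (\<lambda>\<omega>. Q \<omega> \<le> X \<omega>) \<omega>"
    and Q_le: "AE \<omega> in M. lam \<le> cond_prob_given M F (\<lambda>\<omega>. X \<omega> \<le> Q \<omega>) \<omega>"
    using Q by (auto simp: is_cond_quantile_def)
  have "AE \<omega> in M. 1 - lam \<le> cond_prob_given M F (\<lambda>\<omega>. ?Q \<omega> \<le> X \<omega>) \<omega>"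
    using Q_ge ge 1 2 AE_space
  proof eventually_elim
    case (elim \<omega>)
    with sp[of \<omega>] show ?case by (cases "\<omega> \<in> A") auto
  qed
  moreover have "AE \<omega> in M. lam \<le> cond_prob_given M F (\<lambda>\<omega>. X \<omega> \<le> ?Q \<omega>) \<omega>"
    using Q_le le 3 4 AE_space
  proof eventually_elim
    case (elim \<omega>)
    with sp[of \<omega>] show ?case by (cases "\<omega> \<in> A") auto
  qed
  ultimately show ?thesis using Q'_F by (simp add: is_cond_quantile_def)
qed

text \<open>If \<open>P(X \<le> q | F) \<ge> lam\<close> held with positive probability on \<open>q < Q\<close>, or \<open>\<le> lam\<close> on
  \<open>Q < q\<close>, then replacing \<open>Q\<close> by \<open>q\<close> there would give a second version of the quantile.\<close>

lemma unique_cond_quantile_strict: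
  assumes X[measurable]: "X \<in> borel_measurable M"
    and Q: "is_cond_quantile M F lam X Q" and unique: "cond_quantile_unique M F lam X"
  shows "AE \<omega> in M. (q < Q \<omega> \<longrightarrow> cond_prob_given M F (\<lambda>\<omega>. X \<omega> \<le> q) \<omega> < lam) \<and>
    (Q \<omega> < q \<longrightarrow> lam < cond_prob_given M F (\<lambda>\<omega>. X \<omega> \<le> q) \<omega>)"
proof -
  let ?p = "cond_prob_given M F (\<lambda>\<omega>. X \<omega> \<le> q)"
  have sp: "space F = space M" using subalg by (simp add: subalgebra_def)
  have Q_F[measurable]: "Q \<in> borel_measurable F" using Q by (simp add: is_cond_quantile_def)
  have [measurable]: "Q \<in> borel_measurable M"
    by (rule measurable_from_subalg[OF subalg Q_F])
  have p[measurable]: "?p \<in> borel_measurable F" by (simp add: cond_prob_given_def)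
  have Q_ge: "AE \<omega> in M. 1 - lam \<le> cond_prob_given M F (\<lambda>\<omega>. Q \<omega> \<le> X \<omega>) \<omega>"
    and Q_le: "AE \<omega> in M. lam \<le> cond_prob_given M F (\<lambda>\<omega>. X \<omega> \<le> Q \<omega>) \<omega>"
    using Q by (auto simp: is_cond_quantile_def)
  define A where "A = {\<omega> \<in> space F. q < Q \<omega> \<and> lam \<le> ?p \<omega>}"
  define B where "B = {\<omega> \<in> space F. Q \<omega> < q \<and> ?p \<omega> \<le> lam}"
  have A: "A \<in> sets F" unfolding A_def by measurable
  have B: "B \<in> sets F" unfolding B_def by measurable
  \<comment> \<open>On \<open>A\<close>, \<open>q < Q\<close> makes \<open>Q \<le> X\<close> imply
    \<open>q \<le> X\<close>; the other quantile inequality for \<open>q\<close> is built into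
    \<open>A\<close>.\<close>
  have "AE \<omega> in M. \<omega> \<in> A \<longrightarrow> cond_prob_given M F (\<lambda>\<omega>. Q \<omega> \<le> X \<omega>) \<omega> \<le>
      cond_prob_given M F (\<lambda>\<omega>. q \<le> X \<omega>) \<omega>"
    by (rule cond_prob_mono_on[OF A]) (auto simp: A_def)
  with Q_ge have "AE \<omega> in M. \<omega> \<in> A \<longrightarrow> 1 - lam \<le> cond_prob_given M F (\<lambda>\<omega>. q \<le> X \<omega>) \<omega>"
    by eventually_elim auto
  then have "is_cond_quantile M F lam X (\<lambda>\<omega>. if \<omega> \<in> A then q else Q \<omega>)"
    by (rule is_cond_quantile_If[OF X Q A]) (auto simp: A_def)
  then have neq_A: "AE \<omega> in M. Q \<omega> = (if \<omega> \<in> A then q else Q \<omega>)"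
    using unique Q by (simp add: cond_quantile_unique_def)
  have "AE \<omega> in M. \<omega> \<in> B \<longrightarrow> cond_prob_given M F (\<lambda>\<omega>. X \<omega> \<le> Q \<omega>) \<omega> \<le> ?p \<omega>"
    by (rule cond_prob_mono_on[OF B]) (auto simp: B_def)
  with Q_le have B_le: "AE \<omega> in M. \<omega> \<in> B \<longrightarrow> lam \<le> ?p \<omega>"
    by eventually_elim auto
  \<comment> \<open>On \<open>B\<close>, the inequality for \<open>q \<le> X\<close> comes from the
    smaller event \<open>q < X\<close>, whose conditional probability is
    \<open>1 - ?p \<ge> 1 - lam\<close> there.\<close>
  have "AE \<omega> in M. \<omega> \<in> space F \<longrightarrow> cond_prob_given M F (\<lambda>\<omega>. \<not> X \<omega> \<le> q) \<omega> \<le>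
      cond_prob_given M F (\<lambda>\<omega>. q \<le> X \<omega>) \<omega>"
    by (rule cond_prob_mono_on) auto
  moreover have "AE \<omega> in M. cond_prob_given M F (\<lambda>\<omega>. \<not> X \<omega> \<le> q) \<omega> = 1 - ?p \<omega>"
    by (rule cond_prob_not) simp
  ultimately have "AE \<omega> in M. \<omega> \<in> B \<longrightarrow> 1 - lam \<le> cond_prob_given M F (\<lambda>\<omega>. q \<le> X \<omega>) \<omega>"
    by eventually_elim (auto simp: B_def)
  then have "is_cond_quantile M F lam X (\<lambda>\<omega>. if \<omega> \<in> B then q else Q \<omega>)"
    using B_le by (rule is_cond_quantile_If[OF X Q B])
  then have neq_B: "AE \<omega> in M. Q \<omega> = (if \<omega> \<in> B then q else Q \<omega>)"
    using unique Q by (simp add: cond_quantile_unique_def)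
  \<comment> \<open>Since \<open>Q\<close> differs from \<open>q\<close> on \<open>A\<close> and on
    \<open>B\<close>, almost sure equality of the versions makes both sets null.\<close>
  from neq_A neq_B AE_space show ?thesis
    by eventually_elim (auto simp: A_def B_def sp not_less split: if_splits)
qed

end

section \<open>Almost sure convergence of order statistics via rational thresholds\<close>

theorem theorem4p3:
  fixes M :: "'a measure" and X :: "nat \<Rightarrow> 'a \<Rightarrow> real" and lam :: real and k :: "nat \<Rightarrow> nat"
  assumes "prob_space M"
    and "\<And>n. n \<ge> 1 \<Longrightarrow> X n \<in> borel_measurable M"
    and "strictly_stationary M X"
    and "0 < lam" and "lam < 1"
    and "\<And>n. n \<ge> 1 \<Longrightarrow> 1 \<le> k n \<and> k n \<le> n"
    and "(\<lambda>n. real (k n) / real n) \<longlonglongrightarrow> lam"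
    and "cond_quantile_unique M (invariant_algebra M X) lam (X 1)"
  shows "\<forall>Q. is_cond_quantile M (invariant_algebra M X) lam (X 1) Q \<longrightarrow>
    (AE \<omega> in M. (\<lambda>n. order_stat X (k n) n \<omega>) \<longlonglongrightarrow> Q \<omega>)"
proof (intro allI impI)
  fix Q assume Q: "is_cond_quantile M (invariant_algebra M X) lam (X 1) Q"
  interpret stationary_sequence M X
    using assms by (simp add: stationary_sequence_def stationary_sequence_axioms_def)
  have [measurable]: "X 1 \<in> borel_measurable M" "X (Suc 0) \<in> borel_measurable M"
    by (simp_all add: measurable_X)
  define p where "p q = cond_prob_given M G (\<lambda>\<omega>. X 1 \<omega> \<le> q)" for q
  define avg where "avg q n \<omega> = (\<Sum>j<n. indicator {..q} (X (Suc j) \<omega>)) / real n" for q n \<omega>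
  have "AE \<omega> in M. (\<lambda>n. avg q n \<omega>) \<longlonglongrightarrow> p q \<omega>" for q
  proof -
    have ind: "(indicator {..q} :: real \<Rightarrow> real) \<in> borel_measurable borel" by measurable
    have "AE \<omega> in M. (\<lambda>n. avg q n \<omega>) \<longlonglongrightarrow> real_cond_exp M G (\<lambda>\<omega>. indicator {..q} (X 1 \<omega>)) \<omega>"
      unfolding avg_def by (rule birkhoff_bounded[OF ind, of 1]) (simp add: indicator_def)
    moreover have "AE \<omega> in M. real_cond_exp M G (\<lambda>\<omega>. indicator {..q} (X 1 \<omega>)) \<omega> = p q \<omega>"
      unfolding p_def cond_prob_given_def
      by (intro G.real_cond_exp_cong AE_I2) (auto simp: indicator_def)
    ultimately show ?thesis by eventually_elim simp
  qed
  \<comment> \<open>Countably many thresholds leave a single null set, and rationals suffice to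
    separate \<open>Q \<omega>\<close> from any other real.\<close>
  then have lim: "AE \<omega> in M. \<forall>q\<in>\<rat>. (\<lambda>n. avg q n \<omega>) \<longlonglongrightarrow> p q \<omega>"
    by (simp add: AE_ball_countable countable_rat)
  have "AE \<omega> in M. (q < Q \<omega> \<longrightarrow> p q \<omega> < lam) \<and> (Q \<omega> < q \<longrightarrow> lam < p q \<omega>)" for q
    unfolding p_def by (rule G.unique_cond_quantile_strict) (use Q assms in simp_all)
  then have "AE \<omega> in M. \<forall>q\<in>\<rat>. (q < Q \<omega> \<longrightarrow> p q \<omega> < lam) \<and> (Q \<omega> < q \<longrightarrow> lam < p q \<omega>)"
    by (simp add: AE_ball_countable countable_rat)
  with lim show "AE \<omega> in M. (\<lambda>n. order_stat X (k n) n \<omega>) \<longlonglongrightarrow> Q \<omega>"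
  proof eventually_elim
    case (elim \<omega>)
    have stat: "order_stat X (k n) n \<omega> \<le> q \<longleftrightarrow> real (k n) / n \<le> avg q n \<omega>" if "n \<ge> 1" for n q
      using order_stat_le_iff[of "k n" n X \<omega> q] assms(6)[OF that] that
      by (simp add: avg_def divide_le_cancel)
    show ?case
    proof (rule order_tendstoI)
      fix a assume "a < Q \<omega>"
      then obtain q where q: "q \<in> \<rat>" "a < q" "q < Q \<omega>" using Rats_dense_in_real by blast
      then have "(\<lambda>n. avg q n \<omega>) \<longlonglongrightarrow> p q \<omega>" "p q \<omega> < lam" using elim by auto
      \<comment> \<open>The difference of \<open>avg q n\<close> and \<open>k n / n\<close> tends to
        \<open>p q - lam < 0\<close>; once it is negative, \<open>stat\<close> puts the order
        statistic above \<open>q\<close>, hence above \<open>a\<close>.\<close>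
      from order_tendstoD(2)[OF tendsto_diff[OF this(1) assms(7)], of 0] this(2)
      have "\<forall>\<^sub>F n in sequentially. avg q n \<omega> - k n / n < 0" by simp
      then show "\<forall>\<^sub>F n in sequentially. a < order_stat X (k n) n \<omega>"
        using eventually_ge_at_top[of 1]
      proof eventually_elim
        case (elim n)
        with stat[of n q] q show ?case by simp
      qed
    next
      fix a assume "Q \<omega> < a"
      then obtain q where q: "q \<in> \<rat>" "Q \<omega> < q" "q < a" using Rats_dense_in_real by blast
      then have "(\<lambda>n. avg q n \<omega>) \<longlonglongrightarrow> p q \<omega>" "lam < p q \<omega>" using elim by auto
      from order_tendstoD(1)[OF tendsto_diff[OF this(1) assms(7)], of 0] this(2)
      have "\<forall>\<^sub>F n in sequentially. 0 < avg q n \<omega> - k n / n" by simp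
      then show "\<forall>\<^sub>F n in sequentially. order_stat X (k n) n \<omega> < a"
        using eventually_ge_at_top[of 1]
      proof eventually_elim
        case (elim n)
        with stat[of n q] q show ?case by simp
      qed
    qed
  qed
qed

end
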